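(* (i) Let $C$ be a positive integer. Then for all sufficiently large integers $k$, setting $m=2k$, $b=\frac{k-C}{2k^2+k}$ and $a=1-2kb$, the system $[1/2_s: a,b,\ldots,b]$ with one player of weight $a$ and $m$ players of weight $b$ is a non-trivial Shapley-Shubik fixed point. (ii) Moreover, all non-trivial fixed points are of this form: if $k$ is a positive integer, $m=2k$, and $[1/2_s: a,b,\ldots,b]$ (one player of weight $a$ and $m$ players of weight $b$) is a primitive non-trivial Shapley-Shubik fixed point, then there is a positive integer $C$ such that $b=\frac{k-C}{2k^2+k}$ and $a=1-2kb$.
   Context: For real numbers $a_1,\ldots,a_N\ge 0$ with sum $1$, $V=[1/2_s: a_1,\ldots,a_N]$ denotes the weighted voting system with $N$ players, player $i$ having weight $a_i$, in which a coalition (set of players) is winning if and only if the sum of the weights of its members strictly exceeds $1/2$. Shapley-Shubik power index: for each of the $N!$ orderings of the players, the pivotal player is the one whose weight, when weights are added up from the beginning of the ordering, first makes the partial sum strictly exceed $1/2$. The Shapley-Shubik index of a player is the number of orderings in which it is pivotal divided by $N!$. Let $SS(V)$ be the tuple of Shapley-Shubik indices of players $1,\ldots,N$. $V$ is a Shapley-Shubik fixed point if $SS(V)=(a_1,\ldots,a_N)$. A fixed point is primitive if no player $i$ has $a_i=0$. A fixed point is non-trivial if not all players have the same power. In (i), "for all sufficiently large $k$" means for all $k$ at least some bound that may depend on $C$. *)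

theory Defs
  imports Complex_Main "HOL-Combinatorics.Multiset_Permutations"
begin

text \<open>
  A system \<open>[1/2\<^sub>s: a\<^sub>1, \<dots>, a\<^sub>N]\<close> is represented by its list of weights; the players
  are the list positions \<open>0, \<dots>, N - 1\<close>.
\<close>

definition voting_system :: "real list \<Rightarrow> bool" where
  "voting_system w \<longleftrightarrow> (\<forall>x\<in>set w. 0 \<le> x) \<and> sum_list w = 1"

definition winning :: "real list \<Rightarrow> nat set \<Rightarrow> bool" where
  "winning w S \<longleftrightarrow> (\<Sum>i\<in>S. w ! i) > 1/2"

definition orderings :: "real list \<Rightarrow> nat list set" where
  "orderings w = permutations_of_set {..<length w}"

definition pivotal :: "real list \<Rightarrow> nat list \<Rightarrow> nat \<Rightarrow> bool" where
  "pivotal w \<sigma> i \<longleftrightarrow>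
     (\<exists>t<length \<sigma>. \<sigma> ! t = i \<and> winning w (set (take (Suc t) \<sigma>)) \<and>
        (\<forall>s\<le>t. \<not> winning w (set (take s \<sigma>))))"

definition SS_index :: "real list \<Rightarrow> nat \<Rightarrow> real" where
  "SS_index w i = real (card {\<sigma> \<in> orderings w. pivotal w \<sigma> i}) / fact (length w)"

definition SS :: "real list \<Rightarrow> real list" where
  "SS w = map (SS_index w) [0..<length w]"

definition SS_fixed_point :: "real list \<Rightarrow> bool" where
  "SS_fixed_point w \<longleftrightarrow> voting_system w \<and> SS w = w"

definition primitive_system :: "real list \<Rightarrow> bool" where
  "primitive_system w \<longleftrightarrow> (\<forall>i<length w. w ! i \<noteq> 0)"

definition nontrivial_system :: "real list \<Rightarrow> bool" where
  "nontrivial_system w \<longleftrightarrow>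
     \<not> (\<forall>i<length w. \<forall>j<length w. SS_index w i = SS_index w j)"

end

theory Submission imports Defs begin

text \<open>
  The large player is pivotal exactly when the number \<open>j\<close> of small players preceding it satisfies
  \<open>j b \<le> 1/2 < a + j b\<close>. All \<open>m + 1\<close> values of \<open>j\<close> are equally likely, and the indices sum to 1
  with equal values on the small players, so a fixed point is characterised by \<open>(m + 1) a\<close> being the
  number of such \<open>j\<close>. Since \<open>a = 1 - m b\<close>, the condition reads \<open>j b \<le> 1/2\<close> and
  \<open>(m - j) b < 1/2\<close>, which is symmetric under \<open>j \<mapsto> m - j\<close> unless \<open>f b = 1/2\<close> for some integer
  \<open>f\<close>. For \<open>m = 2 k\<close> the count is thus an odd number \<open>2 C + 1\<close>, or else \<open>2 c\<close> with
  \<open>f = k + c\<close>; in the latter case the fixed point equation becomes \<open>c = 2 c\<^sup>2\<close>, which is impossible.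
\<close>

section \<open>Permutations with one prescribed entry\<close>

text \<open>Deleting the entry at position \<open>t\<close> is a bijection onto the permutations of
  \<open>A - {x}\<close>; its inverse inserts \<open>x\<close> there. This makes every position of a
  given player equally likely.\<close>

lemma card_permutations_of_set_nth:
  assumes "finite A" "x \<in> A" "t < card A"
  shows "card {\<sigma> \<in> permutations_of_set A. \<sigma> ! t = x} = fact (card A - 1)"
proof -
  let ?ins = "\<lambda>\<tau>. take t \<tau> @ x # drop t \<tau>"
  let ?del = "\<lambda>\<sigma>. take t \<sigma> @ drop (Suc t) \<sigma>"
  have "bij_betw ?ins (permutations_of_set (A - {x})) {\<sigma> \<in> permutations_of_set A. \<sigma> ! t = x}"
  proof (rule bij_betw_byWitness[where f' = ?del])
    have len: "t \<le> length \<tau>" if "\<tau> \<in> permutations_of_set (A - {x})" for \<tau>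
      using length_finite_permutations_of_set[OF that] assms by simp
    show "\<forall>\<tau>\<in>permutations_of_set (A - {x}). ?del (?ins \<tau>) = \<tau>"
      using len by (auto simp: min_def)
    have split: "\<sigma> = take t \<sigma> @ x # drop (Suc t) \<sigma>"
      if "\<sigma> \<in> permutations_of_set A" "\<sigma> ! t = x" for \<sigma>
      using id_take_nth_drop[of t \<sigma>] length_finite_permutations_of_set[OF that(1)] that assms
      by simp
    show "\<forall>\<sigma>\<in>{\<sigma> \<in> permutations_of_set A. \<sigma> ! t = x}. ?ins (?del \<sigma>) = \<sigma>"
    proof clarify
      fix \<sigma> assume "\<sigma> \<in> permutations_of_set A" "x = \<sigma> ! t"
      moreover from this have "length \<sigma> = card A"
        by (simp add: length_finite_permutations_of_set)
      ultimately show "take t (?del \<sigma>) @ \<sigma> ! t # drop t (?del \<sigma>) = \<sigma>"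
        using assms split[of \<sigma>] by (simp add: min_def)
    qed
    show "?ins ` permutations_of_set (A - {x}) \<subseteq> {\<sigma> \<in> permutations_of_set A. \<sigma> ! t = x}"
    proof clarify
      fix \<tau> assume \<tau>: "\<tau> \<in> permutations_of_set (A - {x})"
      \<comment> \<open>Multisets forget where \<open>x\<close> was inserted, so the entries and
        distinctness can be read off from \<open>x # \<tau>\<close>.\<close>
      have "mset (?ins \<tau>) = add_mset x (mset (take t \<tau> @ drop t \<tau>))"
        by (simp del: append_take_drop_id)
      also have "\<dots> = mset (x # \<tau>)"
        by simp
      finally have "set (?ins \<tau>) = set (x # \<tau>)" "distinct (?ins \<tau>) \<longleftrightarrow> distinct (x # \<tau>)"
        by (fact mset_eq_setD mset_eq_imp_distinct_iff)+
      then have "?ins \<tau> \<in> permutations_of_set A"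
        using permutations_of_setD[OF \<tau>] assms(2) by (intro permutations_of_setI) auto
      moreover have "?ins \<tau> ! t = x"
        using len[OF \<tau>] by (simp add: nth_append)
      ultimately show "?ins \<tau> \<in> permutations_of_set A \<and> ?ins \<tau> ! t = x" ..
    qed
    show "?del ` {\<sigma> \<in> permutations_of_set A. \<sigma> ! t = x} \<subseteq> permutations_of_set (A - {x})"
    proof (intro image_subsetI, elim CollectE conjE)
      fix \<sigma> assume \<sigma>: "\<sigma> \<in> permutations_of_set A" "\<sigma> ! t = x"
      have "set (take t \<sigma> @ x # drop (Suc t) \<sigma>) = A"
        "distinct (take t \<sigma> @ x # drop (Suc t) \<sigma>)"
        by (simp_all only: split[OF \<sigma>, symmetric] permutations_of_setD[OF \<sigma>(1)])
      then show "?del \<sigma> \<in> permutations_of_set (A - {x})"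
        by (intro permutations_of_setI) auto
    qed
  qed
  from bij_betw_same_card[OF this] show ?thesis
    using assms by simp
qed

section \<open>General properties of pivots and indices\<close>

lemma orderingsD:
  assumes "\<sigma> \<in> orderings w"
  shows "set \<sigma> = {..<length w}" "distinct \<sigma>" "length \<sigma> = length w"
  using assms permutations_of_setD length_finite_permutations_of_set
  by (fastforce simp: orderings_def)+

lemma finite_orderings [simp]: "finite (orderings w)"
  by (simp add: orderings_def)

lemma card_orderings: "card (orderings w) = fact (length w)"
  by (simp add: orderings_def)

text \<open>Of two pivot positions, the smaller would already yield a winning prefix that the larger
  requires to be losing.\<close>

lemma pivotal_unique:
  assumes "distinct \<sigma>" "pivotal w \<sigma> i" "pivotal w \<sigma> j"
  shows "i = j"
proof -
  obtain t where t: "\<sigma> ! t = i" "winning w (set (take (Suc t) \<sigma>))"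
      "\<forall>s\<le>t. \<not> winning w (set (take s \<sigma>))"
    using assms(2) by (auto simp: pivotal_def)
  obtain u where u: "\<sigma> ! u = j" "winning w (set (take (Suc u) \<sigma>))"
      "\<forall>s\<le>u. \<not> winning w (set (take s \<sigma>))"
    using assms(3) by (auto simp: pivotal_def)
  have "\<not> t < u" "\<not> u < t"
    using t u Suc_leI by blast+
  then show ?thesis
    using t u by auto
qed

lemma pivotal_exists:
  assumes "sum_list w > 1/2" "\<sigma> \<in> orderings w"
  shows "\<exists>i<length w. pivotal w \<sigma> i"
proof -
  note \<sigma> = orderingsD[OF assms(2)]
  let ?P = "\<lambda>s. winning w (set (take s \<sigma>))"
  have full: "?P (length \<sigma>)"
    using assms(1) by (simp add: winning_def \<sigma>(1) sum_list_sum_nth atLeast0LessThan)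
  have "\<not> ?P 0"
    by (simp add: winning_def)
  \<comment> \<open>The empty prefix loses, so the shortest winning prefix has positive length, and
    its last entry is the pivot.\<close>
  then obtain t where t: "Least ?P = Suc t"
    using LeastI[of ?P, OF full] by (metis not0_implies_Suc)
  have "t < length \<sigma>"
    using Least_le[of ?P, OF full] t by simp
  moreover have "?P (Suc t)"
    using LeastI[of ?P, OF full] t by simp
  moreover have "\<forall>s\<le>t. \<not> ?P s"
    using not_less_Least[of _ ?P] t by auto
  ultimately have "pivotal w \<sigma> (\<sigma> ! t)"
    unfolding pivotal_def by blast
  moreover have "\<sigma> ! t < length w"
    using \<open>t < length \<sigma>\<close> \<sigma>(1) nth_mem by blast
  ultimately show ?thesis by blast
qed

text \<open>Each ordering has exactly one pivotal player, so the orderings are partitioned according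
  to their pivot.\<close>

lemma sum_SS_index:
  assumes "sum_list w > 1/2"
  shows "(\<Sum>i<length w. SS_index w i) = 1"
proof -
  let ?S = "\<lambda>i. {\<sigma> \<in> orderings w. pivotal w \<sigma> i}"
  have "(\<Sum>i<length w. card (?S i)) = card (\<Union>i<length w. ?S i)"
    by (rule card_UN_disjoint[symmetric]) (auto dest: pivotal_unique orderingsD(2))
  also have "(\<Union>i<length w. ?S i) = orderings w"
    using pivotal_exists[OF assms] by blast
  finally have "real (\<Sum>i<length w. card (?S i)) = fact (length w)"
    by (simp add: card_orderings)
  then show ?thesis
    by (simp add: SS_index_def flip: sum_divide_distrib)
qed

text \<open>Transposing two players of equal weight preserves all coalition weights, so it exchanges
  the orderings in which one is pivotal with those in which the other is.\<close>

lemma SS_index_eq_of_weight_eq: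
  assumes "i < length w" "j < length w" "w ! i = w ! j"
  shows "SS_index w i = SS_index w j"
proof -
  define p where "p = transpose i j"
  have invol: "p (p x) = x" for x
    by (simp add: p_def)
  have inj: "inj p"
    by (metis injI invol)
  have "w ! p x = w ! x" for x
    using assms by (auto simp: p_def transpose_def)
  then have win: "winning w (p ` S) = winning w S" for S
    using inj by (simp add: winning_def sum.reindex[OF inj_on_subset[OF inj]])
  have piv: "pivotal w (map p \<sigma>) (p l)" if "pivotal w \<sigma> l" for \<sigma> l
    using that by (auto simp: pivotal_def take_map win)
  have p_less: "p x < length w" if "x < length w" for x
    using that assms by (auto simp: p_def transpose_def)
  then have p_lessThan: "p ` {..<length w} = {..<length w}"
    by (metis (no_types, lifting) bij_betw_def bij_betw_byWitness[of "{..<length w}" p p] image_subsetI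
      invol lessThan_iff)
  have ord: "map p \<sigma> \<in> orderings w" if "\<sigma> \<in> orderings w" for \<sigma>
    using orderingsD[OF that] p_lessThan inj_on_subset[OF inj]
    by (simp add: orderings_def distinct_map permutations_of_setI)
  have p_ij: "p i = j" "p j = i"
    by (simp_all add: p_def)
  have "bij_betw (map p) {\<sigma> \<in> orderings w. pivotal w \<sigma> i} {\<sigma> \<in> orderings w. pivotal w \<sigma> j}"
  proof (rule bij_betw_byWitness[where f' = "map p"])
    show "map p ` {\<sigma> \<in> orderings w. pivotal w \<sigma> i} \<subseteq> {\<sigma> \<in> orderings w. pivotal w \<sigma> j}"
      using ord piv[of _ i] p_ij by auto
    show "map p ` {\<sigma> \<in> orderings w. pivotal w \<sigma> j} \<subseteq> {\<sigma> \<in> orderings w. pivotal w \<sigma> i}"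
      using ord piv[of _ j] p_ij by auto
  qed (simp_all add: invol comp_def)
  from bij_betw_same_card[OF this] show ?thesis
    by (simp add: SS_index_def)
qed

section \<open>One large player among equal small players\<close>

lemma pivotal_large_player_iff:
  fixes a b :: real
  assumes "b \<ge> 0" "\<sigma> \<in> orderings (a # replicate m b)"
  shows "pivotal (a # replicate m b) \<sigma> 0 \<longleftrightarrow>
    (\<exists>t\<le>m. \<sigma> ! t = 0 \<and> real t * b \<le> 1/2 \<and> a + real t * b > 1/2)"
proof -
  let ?w = "a # replicate m b"
  note \<sigma> = orderingsD[OF assms(2)]
  have len: "length \<sigma> = Suc m"
    using \<sigma>(3) by simp
  have notin: "0 \<notin> set (take s \<sigma>)" if "\<sigma> ! t = 0" "t \<le> m" "s \<le> t" for s t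
  proof
    assume "0 \<in> set (take s \<sigma>)"
    then obtain i where "i < s" "i < length \<sigma>" "\<sigma> ! i = 0"
      by (auto simp: in_set_conv_nth)
    then show False
      using that nth_eq_iff_index_eq[OF \<sigma>(2), of i t] len by simp
  qed
  have small: "(\<Sum>i\<in>set (take s \<sigma>). ?w ! i) = real s * b"
    if "\<sigma> ! t = 0" "t \<le> m" "s \<le> t" for s t
  proof -
    have "set (take s \<sigma>) \<subseteq> {..<Suc m}"
      using set_take_subset[of s \<sigma>] \<sigma>(1) by simp
    then have "?w ! i = b" if "i \<in> set (take s \<sigma>)" for i
      using that notin[OF \<open>\<sigma> ! t = 0\<close> \<open>t \<le> m\<close> \<open>s \<le> t\<close>] by (cases i) auto
    then have "(\<Sum>i\<in>set (take s \<sigma>). ?w ! i) = (\<Sum>i\<in>set (take s \<sigma>). b)"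
      by simp
    also have "\<dots> = real s * b"
      using that len distinct_card[of "take s \<sigma>"] \<sigma>(2) by simp
    finally show ?thesis .
  qed
  have large: "(\<Sum>i\<in>set (take (Suc t) \<sigma>). ?w ! i) = a + real t * b"
    if "\<sigma> ! t = 0" "t \<le> m" for t
  proof -
    have "take (Suc t) \<sigma> = take t \<sigma> @ [0]"
      using that len by (simp add: take_Suc_conv_app_nth)
    then show ?thesis
      using small[OF that order_refl] notin[OF that order_refl] by simp
  qed
  \<comment> \<open>Since \<open>b \<ge> 0\<close>, prefix weights do not decrease before the large
    player, so only the longest of these prefixes needs checking.\<close>
  have "(\<forall>s\<le>t. \<not> real s * b > 1/2) \<longleftrightarrow> real t * b \<le> 1/2" for t
  proof -
    have "real s * b \<le> real t * b" if "s \<le> t" for s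
      using assms(1) that by (simp add: mult_right_mono)
    then show ?thesis
      by (meson linorder_not_less order_refl order_trans)
  qed
  moreover have "(winning ?w (set (take (Suc t) \<sigma>)) \<and> (\<forall>s\<le>t. \<not> winning ?w (set (take s \<sigma>))))
      \<longleftrightarrow> a + real t * b > 1/2 \<and> (\<forall>s\<le>t. \<not> real s * b > 1/2)" if "\<sigma> ! t = 0" "t \<le> m" for t
    unfolding winning_def using small[OF that] large[OF that] by simp
  ultimately show ?thesis
    unfolding pivotal_def len less_Suc_eq_le by blast
qed

text \<open>Each pivotal position \<open>t\<close> of player 0 is realised by \<open>fact m\<close>
  of the \<open>fact (Suc m)\<close> orderings, and distinctness keeps different positions
  disjoint.\<close>

lemma SS_index_large_player:
  fixes a b :: real
  assumes "b \<ge> 0"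
  shows "SS_index (a # replicate m b) 0 =
    real (card {t. t \<le> m \<and> real t * b \<le> 1/2 \<and> a + real t * b > 1/2}) / real (Suc m)"
proof -
  let ?w = "a # replicate m b"
  let ?T = "{t. t \<le> m \<and> real t * b \<le> 1/2 \<and> a + real t * b > 1/2}"
  let ?S = "\<lambda>t. {\<sigma> \<in> permutations_of_set {..<Suc m}. \<sigma> ! t = 0}"
  have ord: "orderings ?w = permutations_of_set {..<Suc m}"
    by (simp add: orderings_def)
  have "{\<sigma> \<in> orderings ?w. pivotal ?w \<sigma> 0} = (\<Union>t\<in>?T. ?S t)"
    using pivotal_large_player_iff[OF assms, of _ a m] unfolding ord by auto
  moreover have "card (\<Union>t\<in>?T. ?S t) = (\<Sum>t\<in>?T. card (?S t))"
  proof (rule card_UN_disjoint)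
    have "t = u" if "t \<le> m" "u \<le> m" "\<sigma> \<in> ?S t" "\<sigma> \<in> ?S u" for t u \<sigma>
    proof -
      have "\<sigma> \<in> orderings ?w"
        using that ord by simp
      from orderingsD[OF this] show ?thesis
        using that nth_eq_iff_index_eq[of \<sigma> t u] by simp
    qed
    then show "\<forall>t\<in>?T. \<forall>u\<in>?T. t \<noteq> u \<longrightarrow> ?S t \<inter> ?S u = {}"
      by blast
  qed auto
  moreover have "(\<Sum>t\<in>?T. card (?S t)) = card ?T * fact m"
    by (simp add: card_permutations_of_set_nth)
  ultimately show ?thesis
    by (simp add: SS_index_def del: of_nat_Suc)
qed

text \<open>Once the large player's index is \<open>a\<close>, the small players share the remaining
  \<open>m * b\<close> equally by symmetry, so a single equation decides the fixed point
  property.\<close>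

lemma SS_fixed_point_one_large_iff:
  fixes a b :: real
  assumes "a \<ge> 0" "b \<ge> 0" "a + real m * b = 1"
  shows "SS_fixed_point (a # replicate m b) \<longleftrightarrow> SS_index (a # replicate m b) 0 = a"
proof
  let ?w = "a # replicate m b"
  have vs: "voting_system ?w"
    using assms by (simp add: voting_system_def sum_list_replicate)
  assume large: "SS_index ?w 0 = a"
  have small: "SS_index ?w (Suc i) = b" if "i < m" for i
  proof -
    have eq: "SS_index ?w (Suc l) = SS_index ?w (Suc i)" if "l < m" for l
      using that \<open>i < m\<close> by (intro SS_index_eq_of_weight_eq) auto
    have "(\<Sum>l<Suc m. SS_index ?w l) = 1"
      using sum_SS_index[of ?w] vs by (simp add: voting_system_def)
    then have "a + (\<Sum>l<m. SS_index ?w (Suc l)) = 1"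
      unfolding sum.lessThan_Suc_shift large .
    also have "(\<Sum>l<m. SS_index ?w (Suc l)) = (\<Sum>l<m. SS_index ?w (Suc i))"
      by (intro sum.cong refl eq) simp
    finally have "a + real m * SS_index ?w (Suc i) = a + real m * b"
      using assms(3) by simp
    then show ?thesis
      using that by simp
  qed
  have "SS ?w ! l = ?w ! l" if "l < Suc m" for l
    using that large small by (cases l) (simp_all add: SS_def del: upt_Suc)
  then have "SS ?w = ?w"
    by (intro nth_equalityI) (simp_all add: SS_def)
  then show "SS_fixed_point ?w"
    using vs by (simp add: SS_fixed_point_def)
next
  assume "SS_fixed_point (a # replicate m b)"
  then have "SS (a # replicate m b) ! 0 = a"
    by (simp add: SS_fixed_point_def)
  then show "SS_index (a # replicate m b) 0 = a"
    by (simp add: SS_def del: upt_Suc)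
qed

lemma SS_fixed_pointD:
  assumes "SS_fixed_point w" "i < length w"
  shows "SS_index w i = w ! i"
proof -
  have "SS w ! i = SS_index w i"
    using assms(2) by (simp add: SS_def)
  then show ?thesis
    using assms(1) by (simp add: SS_fixed_point_def)
qed

text \<open>At a fixed point the indices are the weights themselves; \<open>m > 0\<close> supplies a
  small player to compare with the large one.\<close>

lemma nontrivial_iff_weights_differ:
  assumes "SS_fixed_point (a # replicate m b)" "m > 0"
  shows "nontrivial_system (a # replicate m b) \<longleftrightarrow> a \<noteq> b"
proof -
  let ?w = "a # replicate m b"
  have "nontrivial_system ?w \<longleftrightarrow> \<not> (\<forall>i<length ?w. \<forall>j<length ?w. ?w ! i = ?w ! j)"
    using SS_fixed_pointD[OF assms(1)] by (simp add: nontrivial_system_def)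
  also have "(\<forall>i<length ?w. \<forall>j<length ?w. ?w ! i = ?w ! j) \<longleftrightarrow> a = b"
  proof
    assume "\<forall>i<length ?w. \<forall>j<length ?w. ?w ! i = ?w ! j"
    then have "?w ! 0 = ?w ! 1"
      using assms(2) by (metis length_Cons length_replicate One_nat_def Suc_mono zero_less_Suc)
    then show "a = b"
      using assms(2) by simp
  next
    assume "a = b"
    then show "\<forall>i<length ?w. \<forall>j<length ?w. ?w ! i = ?w ! j"
      by (simp flip: replicate_Suc)
  qed
  finally show ?thesis .
qed

section \<open>Thresholds and the interval of pivotal positions\<close>

text \<open>The non-strict threshold \<open>f\<close> bounds the players before the large one, the
  strict threshold \<open>g\<close> those after it. They are kept apart because they differ when
  some multiple of \<open>b\<close> is exactly 1/2.\<close>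

lemma pivotal_positions_eq_atLeastAtMost:
  fixes a b :: real and f g m :: nat
  assumes "a + real m * b = 1" "f \<le> m" "g \<le> m"
    and f: "\<And>j. j \<le> m \<Longrightarrow> real j * b \<le> 1/2 \<longleftrightarrow> j \<le> f"
    and g: "\<And>j. j \<le> m \<Longrightarrow> real j * b < 1/2 \<longleftrightarrow> j \<le> g"
  shows "{t. t \<le> m \<and> real t * b \<le> 1/2 \<and> a + real t * b > 1/2} = {m - g..f}"
proof -
  have "a + real t * b > 1/2 \<longleftrightarrow> m - g \<le> t" if "t \<le> m" for t
  proof -
    \<comment> \<open>The large player and its predecessors win exactly when the
      \<open>m - t\<close> small players after it weigh less than 1/2.\<close>
    have "a + real t * b > 1/2 \<longleftrightarrow> real (m - t) * b < 1/2"
      using assms(1) that by (auto simp: of_nat_diff algebra_simps)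
    also have "\<dots> \<longleftrightarrow> m - g \<le> t"
      using g[of "m - t"] that by linarith
    finally show ?thesis .
  qed
  then show ?thesis
    using f assms(2) by auto
qed

lemma threshold_exists:
  fixes b :: real
  assumes "b > 0"
  obtains f where "f \<le> m" "\<And>j. j \<le> m \<Longrightarrow> real j * b \<le> 1/2 \<longleftrightarrow> j \<le> f"
proof
  let ?x = "1 / (2 * b)"
  \<comment> \<open>Capping at \<open>m\<close> secures \<open>f \<le> m\<close> and changes nothing
    for \<open>j \<le> m\<close>.\<close>
  show "min m (nat \<lfloor>?x\<rfloor>) \<le> m" by simp
  fix j assume "j \<le> m"
  have "real j * b \<le> 1/2 \<longleftrightarrow> real j \<le> ?x"
    using assms by (simp add: field_simps)
  also have "\<dots> \<longleftrightarrow> j \<le> nat \<lfloor>?x\<rfloor>"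
    using assms by (simp add: le_nat_floor le_nat_iff le_floor_iff)
  finally show "real j * b \<le> 1/2 \<longleftrightarrow> j \<le> min m (nat \<lfloor>?x\<rfloor>)"
    using \<open>j \<le> m\<close> by simp
qed

section \<open>The family of fixed points and its completeness\<close>

text \<open>Both thresholds equal \<open>k + C\<close>, so there are \<open>2 * C + 1\<close>
  pivotal positions out of \<open>2 * k + 1\<close>, which is the ratio \<open>a\<close>.\<close>

lemma fixed_point_family:
  fixes C k :: nat and a b :: real
  assumes k: "k > 2 * C\<^sup>2 + 2 * C"
    and C: "C > 0"
    and b: "b = (real k - real C) / (2 * (real k)\<^sup>2 + real k)"
    and a: "a = 1 - 2 * real k * b"
  shows "SS_fixed_point (a # replicate (2 * k) b) \<and> nontrivial_system (a # replicate (2 * k) b)"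
proof -
  have kC: "k > C" using k by simp
  have denom: "2 * (real k)\<^sup>2 + real k > 0"
    using kC by (intro add_nonneg_pos) simp_all
  have "2 * (real k)\<^sup>2 + real k = real k * (2 * real k + 1)"
    by (simp add: power2_eq_square algebra_simps)
  then have b': "b * (real k * (2 * real k + 1)) = real k - real C"
    using b kC by simp
  then have "real k * (b * (2 * real k + 1)) = real k - real C"
    by (simp only: mult_ac)
  then have "real k * (a * (2 * real k + 1)) = real k * (2 * real C + 1)"
    unfolding a by algebra
  then have a': "a * (2 * real k + 1) = 2 * real C + 1"
    using kC by simp
  then have a_eq: "a = (2 * real C + 1) / real (Suc (2 * k))"
    by (simp add: field_simps)
  have b_pos: "b > 0"
    using b kC denom by simp
  have a_pos: "a > 0"
    by (simp add: a_eq)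
  have sum1: "a + real (2 * k) * b = 1"
    using a by simp
  have below: "real (k + C) * b < 1/2"
  proof -
    have "2 * ((real k + real C) * (real k - real C)) < 2 * (real k)\<^sup>2 + real k"
      using kC by (simp add: power2_eq_square algebra_simps add_pos_nonneg)
    then show ?thesis
      unfolding b using denom by (simp add: divide_less_eq mult_ac)
  qed
  \<comment> \<open>After clearing denominators this is precisely
    \<open>k > 2 * C\<^sup>2 + 2 * C\<close>, the source of the bound on \<open>k\<close>.\<close>
  have above: "real (Suc (k + C)) * b > 1/2"
  proof -
    have "real k > real (2 * C\<^sup>2 + 2 * C)"
      using k by (simp only: of_nat_less_iff)
    then have "2 * ((real k + real C + 1) * (real k - real C)) > 2 * (real k)\<^sup>2 + real k"
      by (simp add: power2_eq_square algebra_simps)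
    then show ?thesis
      unfolding b using denom by (simp add: less_divide_eq add_ac mult_ac)
  qed
  have below_mono: "real j * b < 1/2" if "j \<le> k + C" for j
  proof -
    have "real j * b \<le> real (k + C) * b"
      using that b_pos by (intro mult_right_mono) simp_all
    with below show ?thesis by simp
  qed
  have above_mono: "real j * b > 1/2" if "\<not> j \<le> k + C" for j
  proof -
    have "real (Suc (k + C)) * b \<le> real j * b"
      using that b_pos by (intro mult_right_mono) simp_all
    with above show ?thesis by simp
  qed
  have "{t. t \<le> 2 * k \<and> real t * b \<le> 1/2 \<and> a + real t * b > 1/2} = {2 * k - (k + C)..k + C}"
    using below_mono above_mono kC
    by (intro pivotal_positions_eq_atLeastAtMost[OF sum1]) (force simp: not_less)+
  then have "SS_index (a # replicate (2 * k) b) 0 = a"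
    using SS_index_large_player[of b a "2 * k"] b_pos kC by (simp add: a_eq)
  then have fp: "SS_fixed_point (a # replicate (2 * k) b)"
    using SS_fixed_point_one_large_iff[OF _ _ sum1] a_pos b_pos by simp
  \<comment> \<open>Over the common denominator \<open>k * (2 * k + 1)\<close> the numerators are
    \<open>k * (2 * C + 1)\<close> and \<open>k - C\<close>, and the first is larger.\<close>
  moreover have "a \<noteq> b"
  proof
    assume "a = b"
    have "real k * (2 * real C + 1) = b * (real k * (2 * real k + 1))"
      unfolding a'[symmetric] \<open>a = b\<close> by (simp only: mult_ac)
    then have "real k * (2 * real C + 1) = real k - real C"
      unfolding b' .
    moreover have "real k * (2 * real C + 1) \<ge> real k"
      by (simp add: algebra_simps)
    ultimately show False
      using C by simp
  qed
  ultimately show ?thesis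
    using nontrivial_iff_weights_differ[OF fp] kC by simp
qed

text \<open>The threshold \<open>f\<close> determines the number of pivotal positions and hence
  \<open>a\<close>. The witness is \<open>C = f - k\<close>, and the case \<open>f * b = 1/2\<close>
  is contradictory.\<close>

lemma fixed_point_classification:
  fixes k :: nat and a b :: real
  assumes k: "k > 0"
    and fp: "SS_fixed_point (a # replicate (2 * k) b)"
    and prim: "primitive_system (a # replicate (2 * k) b)"
    and nontriv: "nontrivial_system (a # replicate (2 * k) b)"
  shows "\<exists>C::nat. C > 0 \<and> b = (real k - real C) / (2 * (real k)\<^sup>2 + real k) \<and>
    a = 1 - 2 * real k * b"
proof -
  have "a \<ge> 0" "b \<ge> 0" and sum1: "a + real (2 * k) * b = 1"
    using fp k by (simp_all add: SS_fixed_point_def voting_system_def sum_list_replicate)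
  moreover have "a \<noteq> 0" "b \<noteq> 0"
    using prim k by (force simp: primitive_system_def)+
  ultimately have pos: "a > 0" "b > 0"
    by simp_all
  have ab: "a \<noteq> b"
    using nontrivial_iff_weights_differ[OF fp] nontriv k by simp
  obtain f where f: "f \<le> 2 * k" "\<And>j. j \<le> 2 * k \<Longrightarrow> real j * b \<le> 1/2 \<longleftrightarrow> j \<le> f"
    using threshold_exists[OF pos(2), of "2 * k"] by blast
  have count: "a * (2 * real k + 1) =
      real (card {t. t \<le> 2 * k \<and> real t * b \<le> 1/2 \<and> a + real t * b > 1/2})"
    using SS_fixed_pointD[OF fp, of 0] SS_index_large_player[of b a "2 * k"] pos
    by (simp add: field_simps)
  have denom: "2 * (real k)\<^sup>2 + real k > 0"
    using k by (intro add_nonneg_pos) simp_all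
  have kb: "real k * b < 1/2"
    using sum1 pos by simp
  then have fk: "k \<le> f"
    using f(2)[of k] by simp
  show ?thesis
  proof (cases "real f * b = 1/2")
    case False
    \<comment> \<open>Without equality at \<open>f\<close>, no multiple of \<open>b\<close> up to
      \<open>2 * k\<close> hits 1/2, so the strict and non-strict thresholds coincide.\<close>
    have "real j * b < 1/2 \<longleftrightarrow> j \<le> f" if "j \<le> 2 * k" for j
    proof
      assume "j \<le> f"
      then have "real j * b \<le> real f * b"
        using pos by simp
      then show "real j * b < 1/2"
        using False f by force
    qed (use f that in force)
    from pivotal_positions_eq_atLeastAtMost[OF sum1 f(1) f(1) f(2) this]
    have a': "a * (2 * real k + 1) = 2 * real (f - k) + 1"
      using count fk f(1) by (simp add: of_nat_diff)
    have "a * (2 * real k + 1) = (1 - 2 * real k * b) * (2 * real k + 1)"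
      using sum1 by (simp add: eq_diff_eq)
    then have "2 * (b * (2 * (real k)\<^sup>2 + real k)) = 2 * (real k - real (f - k))"
      unfolding a' by (simp add: power2_eq_square algebra_simps)
    then have b_eq: "b = (real k - real (f - k)) / (2 * (real k)\<^sup>2 + real k)"
      using denom by (simp add: eq_divide_eq)
    \<comment> \<open>If \<open>f = k\<close>, both weights would equal
      \<open>1 / (2 * k + 1)\<close>, contrary to non-triviality.\<close>
    have "f - k \<noteq> 0"
    proof
      assume "f - k = 0"
      then have "a * (2 * real k + 1) = 1"
        using a' by simp
      moreover have "b * (2 * (real k)\<^sup>2 + real k) = real k"
        using b_eq \<open>f - k = 0\<close> denom by simp
      then have "real k * (b * (2 * real k + 1)) = real k * 1"
        by (simp add: power2_eq_square algebra_simps)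
      then have "b * (2 * real k + 1) = 1"
        using k by simp
      ultimately have "a * (2 * real k + 1) = b * (2 * real k + 1)"
        by simp
      then show False
        using ab by simp
    qed
    then show ?thesis
      using b_eq sum1 by (intro exI[of _ "f - k"]) auto
  next
    case True
    have "f \<noteq> k"
      using True kb by auto
    then have fk': "k < f"
      using fk by simp
    \<comment> \<open>Equality at \<open>f\<close> lowers the strict threshold by one, so the
      interval of pivotal positions loses its left endpoint and its size becomes even.\<close>
    have "real j * b < 1/2 \<longleftrightarrow> j \<le> f - 1" for j
    proof -
      have "real j * b < 1/2 \<longleftrightarrow> real j * b < real f * b"
        by (simp only: True)
      also have "\<dots> \<longleftrightarrow> j \<le> f - 1"
        using pos fk' by auto
      finally show ?thesis .
    qed
    from pivotal_positions_eq_atLeastAtMost[OF sum1 f(1) _ f(2) this]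
    have "a * (2 * real k + 1) = real (Suc f - (2 * k - (f - 1)))"
      using count f(1) by simp
    also have "Suc f - (2 * k - (f - 1)) = 2 * (f - k)"
      using fk' f(1) by simp
    finally have a': "a * (2 * real k + 1) = 2 * real (f - k)"
      by simp
    define c where "c = f - k"
    have "real f = real k + real c"
      using fk' by (simp add: c_def)
    then have b_eq: "2 * ((real k + real c) * b) = 1"
      using True by simp
    have a_eq: "a = 1 - 2 * real k * b"
      using sum1 by simp
    have "a * (real k + real c) = real k + real c - real k * (2 * ((real k + real c) * b))"
      by (simp add: a_eq algebra_simps)
    then have mid: "a * (real k + real c) = real c"
      by (simp add: b_eq)
    \<comment> \<open>Evaluating this product with either factor of \<open>a\<close> first
      eliminates both weights and leaves an equation in \<open>k\<close> and \<open>c\<close>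
      alone.\<close>
    have "a * (2 * real k + 1) * (real k + real c) = a * (real k + real c) * (2 * real k + 1)"
      by (simp only: mult_ac)
    then have "2 * real c * (real k + real c) = real c * (2 * real k + 1)"
      unfolding a' mid c_def[symmetric] .
    then have "real c = 2 * (real c)\<^sup>2"
      by (simp add: power2_eq_square algebra_simps)
    \<comment> \<open>The only positive real solution is 1/2, so passing to natural numbers gives
      the contradiction.\<close>
    then have "real c = real (2 * c\<^sup>2)"
      by simp
    then have "c = 2 * c\<^sup>2"
      by (simp only: of_nat_eq_iff)
    moreover have "c > 0"
      using fk' by (simp add: c_def)
    ultimately show ?thesis
      by (simp add: power2_eq_square)
  qed
qed

theorem proposition3p2:
  "(\<forall>C::nat. C > 0 \<longrightarrow>
      (\<exists>K::nat. \<forall>k\<ge>K. \<forall>(m::nat) (a::real) (b::real).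
         m = 2 * k \<longrightarrow> b = (real k - real C) / (2 * (real k)^2 + real k) \<longrightarrow>
         a = 1 - 2 * real k * b \<longrightarrow>
           SS_fixed_point (a # replicate m b) \<and> nontrivial_system (a # replicate m b)))
   \<and>
   (\<forall>(k::nat) (m::nat) (a::real) (b::real).
      k > 0 \<longrightarrow> m = 2 * k \<longrightarrow>
      SS_fixed_point (a # replicate m b) \<longrightarrow> primitive_system (a # replicate m b) \<longrightarrow>
      nontrivial_system (a # replicate m b) \<longrightarrow>
        (\<exists>C::nat. C > 0 \<and> b = (real k - real C) / (2 * (real k)^2 + real k) \<and>
           a = 1 - 2 * real k * b))"
proof (intro conjI allI impI)
  fix C :: nat assume "C > 0"
  then show "\<exists>K::nat. \<forall>k\<ge>K. \<forall>(m::nat) (a::real) (b::real).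
      m = 2 * k \<longrightarrow> b = (real k - real C) / (2 * (real k)^2 + real k) \<longrightarrow>
      a = 1 - 2 * real k * b \<longrightarrow>
        SS_fixed_point (a # replicate m b) \<and> nontrivial_system (a # replicate m b)"
    using fixed_point_family[of C]
    \<comment> \<open>The successor turns the strict bound of \<open>fixed_point_family\<close> into
      \<open>k \<ge> K\<close>.\<close>
    by (intro exI[of _ "Suc (2 * C\<^sup>2 + 2 * C)"]) (auto simp: Suc_le_eq)
qed (use fixed_point_classification in blast)

end
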